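(* Let $X$ be a complete metric space, let $\varphi_1,\varphi_2\colon X\to\mathbb{R}_\infty$ be lower semicontinuous and $\bar x\in\operatorname{dom}\varphi_1\cap\operatorname{dom}\varphi_2$. Suppose that $\bar x$ is a quasiuniform stationary point of $\varphi_1+\varphi_2$. Then, for any $\varepsilon>0$, there is a $\rho\in(0,\varepsilon)$ such that, for any $\eta>0$, there exist a number $\gamma>0$ and points $\hat x_1,\hat x_2\in X$ such that $$d((\hat x_1,\hat x_2),(\bar x,\bar x))<\rho,\qquad d(\hat x_1,\hat x_2)<\eta,\qquad\varphi_\gamma(\hat x_1,\hat x_2)\le(\varphi_1+\varphi_2)(\bar x),$$ $$\sup_{\substack{u_1,u_2\in\overline B_\rho(\bar x)\\ (u_1,u_2)\ne(\hat x_1,\hat x_2)}}\frac{\varphi_\gamma(\hat x_1,\hat x_2)-\varphi_\gamma(u_1,u_2)}{d((u_1,u_2),(\hat x_1,\hat x_2))}<\varepsilon,$$ where $\varphi_\gamma\colon X\times X\to\mathbb{R}_\infty$ is given by $\varphi_\gamma(u_1,u_2):=\varphi_1(u_1)+\varphi_2(u_2)+\gamma\,d(u_1,u_2)$.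
   Context: $\mathbb{R}_\infty:=\mathbb{R}\cup\{+\infty\}$, $\operatorname{dom}\varphi:=\{x\mid\varphi(x)<+\infty\}$; $B_\delta(x)$, $\overline B_\delta(x)$ are the open and closed balls. $X\times X$ carries the maximum distance. $\inf\emptyset=+\infty$; a quotient in the supremum equals $-\infty$ when $\varphi_\gamma(u_1,u_2)=+\infty$. A set $V\subset X$ is an essentially interior subset of $U\subset X$ if $\bigcup_{x\in V}B_\rho(x)\subset U$ for some $\rho>0$; $EI(U)$ is the collection of all such $V$ (including $\emptyset$). Put $$\Lambda_U^\circ(\varphi_1,\varphi_2):=\lim_{\eta\downarrow0}\ \inf_{x_1,x_2\in U,\ d(x_1,x_2)<\eta}(\varphi_1(x_1)+\varphi_2(x_2)),\qquad \Lambda_U^\dagger(\varphi_1,\varphi_2):=\inf_{V\in EI(U)}\Lambda_V^\circ(\varphi_1,\varphi_2).$$ The point $\bar x$ is a quasiuniform $\varepsilon$-minimum of $\varphi_1+\varphi_2$ on $B_\delta(\bar x)$ if $(\varphi_1+\varphi_2)(\bar x)<\Lambda_{B_\delta(\bar x)}^\dagger(\varphi_1,\varphi_2)+\varepsilon$; it is a quasiuniform stationary point of $\varphi_1+\varphi_2$ if for any $\varepsilon>0$ there is $\delta_\varepsilon>0$ such that, for any $\delta\in(0,\delta_\varepsilon)$, $\bar x$ is a quasiuniform $\varepsilon\delta$-minimum of $\varphi_1+\varphi_2$ on $B_\delta(\bar x)$. *)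

theory Defs
  imports "HOL-Analysis.Analysis"
begin

(* A function into R_infinity is a function f :: 'a => ereal that never takes the value
   -\<infinity>; statements about such functions assume this explicitly. *)

definition eff_dom :: "('a \<Rightarrow> ereal) \<Rightarrow> 'a set" where
  "eff_dom f = {x. f x < \<infinity>}"

(* At an isolated point the filter is trivial and the Liminf is \<infinity>, so no condition is
   imposed there. *)
definition lower_semicontinuous :: "('a::topological_space \<Rightarrow> ereal) \<Rightarrow> bool" where
  "lower_semicontinuous f \<longleftrightarrow> (\<forall>x. f x \<le> Liminf (at x) f)"

(* The library metric on products is the Euclidean one, hence a separate maximum distance. *)
definition max_dist :: "'a::metric_space \<times> 'a \<Rightarrow> 'a \<times> 'a \<Rightarrow> real" where
  "max_dist p q = max (dist (fst p) (fst q)) (dist (snd p) (snd q))"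

definition EI :: "'a::metric_space set \<Rightarrow> 'a set set" where
  "EI U = {V. \<exists>\<rho>>0. (\<Union>x\<in>V. ball x \<rho>) \<subseteq> U}"

(* The infimum increases as \<eta> decreases, so the limit always exists in ereal. *)
definition Lambda_circ ::
  "'a::metric_space set \<Rightarrow> ('a \<Rightarrow> ereal) \<Rightarrow> ('a \<Rightarrow> ereal) \<Rightarrow> ereal" where
  "Lambda_circ U f1 f2 =
     Lim (at_right (0::real))
       (\<lambda>\<eta>. INF (x1, x2)\<in>{(x1, x2). x1 \<in> U \<and> x2 \<in> U \<and> dist x1 x2 < \<eta>}. f1 x1 + f2 x2)"

definition Lambda_dagger ::
  "'a::metric_space set \<Rightarrow> ('a \<Rightarrow> ereal) \<Rightarrow> ('a \<Rightarrow> ereal) \<Rightarrow> ereal" where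
  "Lambda_dagger U f1 f2 = (INF V\<in>EI U. Lambda_circ V f1 f2)"

definition quasiuniform_min ::
  "real \<Rightarrow> real \<Rightarrow> ('a::metric_space \<Rightarrow> ereal) \<Rightarrow> ('a \<Rightarrow> ereal) \<Rightarrow> 'a \<Rightarrow> bool" where
  "quasiuniform_min \<epsilon> \<delta> f1 f2 x \<longleftrightarrow> f1 x + f2 x < Lambda_dagger (ball x \<delta>) f1 f2 + ereal \<epsilon>"

definition quasiuniform_stationary ::
  "('a::metric_space \<Rightarrow> ereal) \<Rightarrow> ('a \<Rightarrow> ereal) \<Rightarrow> 'a \<Rightarrow> bool" where
  "quasiuniform_stationary f1 f2 x \<longleftrightarrow>
     (\<forall>\<epsilon>>0. \<exists>\<delta>\<^sub>\<epsilon>>0. \<forall>\<delta>. 0 < \<delta> \<and> \<delta> < \<delta>\<^sub>\<epsilon> \<longrightarrow> quasiuniform_min (\<epsilon> * \<delta>) \<delta> f1 f2 x)"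

definition penalized ::
  "('a::metric_space \<Rightarrow> ereal) \<Rightarrow> ('a \<Rightarrow> ereal) \<Rightarrow> real \<Rightarrow> 'a \<times> 'a \<Rightarrow> ereal" where
  "penalized f1 f2 \<gamma> u = f1 (fst u) + f2 (snd u) + ereal (\<gamma> * dist (fst u) (snd u))"

end

theory Submission
  imports Defs
begin

text \<open>
  The statement is Ekeland's variational principle applied to the penalized sum
  \<open>\<phi>\<^sub>\<gamma>(u\<^sub>1, u\<^sub>2) = \<phi>\<^sub>1(u\<^sub>1) + \<phi>\<^sub>2(u\<^sub>2) + \<gamma> d(u\<^sub>1, u\<^sub>2)\<close> on the square of a small closed ball
  of radius \<open>\<rho>\<close> about \<open>xbar\<close>, started at \<open>(xbar, xbar)\<close>, where the penalty vanishes.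

  The closed \<open>\<rho>\<close>-ball is essentially interior to the open \<open>2\<rho>\<close>-ball. Hence stationarity with
  the constant \<open>\<epsilon>/4\<close> says that \<open>\<phi>\<^sub>1(u\<^sub>1) + \<phi>\<^sub>2(u\<^sub>2)\<close> exceeds
  \<open>\<phi>\<^sub>1(xbar) + \<phi>\<^sub>2(xbar) - \<epsilon>\<rho>/2\<close> for points of the closed ball that are close enough to each
  other (\<open>quasiuniform_min_lower_bound\<close>). For points that are not close, the penalty takes over:
  by lower semicontinuity both functions are bounded below near \<open>xbar\<close>, so for large \<open>\<gamma>\<close> the
  same bound holds for \<open>\<phi>\<^sub>\<gamma>\<close> on the whole square (\<open>penalized_lower_bound\<close>).

  Thus \<open>(xbar, xbar)\<close> minimizes \<open>\<phi>\<^sub>\<gamma>\<close> on the square up to an error less than \<open>\<epsilon>\<rho>/2\<close>. Ekeland's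
  principle with slope \<open>\<epsilon>/2\<close> (\<open>ekeland\<close>) moves to a point at which the supremum of the quotients
  is at most \<open>\<epsilon>/2\<close>. The value drops by at least \<open>\<epsilon>/2\<close> times the distance travelled, and by
  less than \<open>\<epsilon>\<rho>/2\<close>, so the distance is less than \<open>\<rho>\<close>. As the value of \<open>\<phi>\<^sub>\<gamma>\<close> does not grow and
  the unpenalized part is bounded below, the two components of the new point are at distance
  \<open>O(1/\<gamma>)\<close>, which gives the bound by \<open>\<eta>\<close>.
\<close>

section \<open>Lower semicontinuity\<close>

lemma lower_semicontinuous_iff_open:
  "lower_semicontinuous f \<longleftrightarrow> (\<forall>c. open {x. c < f x})"
proof
  assume lsc: "lower_semicontinuous f"
  show "\<forall>c. open {x. c < f x}"
  proof (intro allI, subst open_subopen, intro ballI)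
    fix c x assume "x \<in> {x. c < f x}"
    hence c: "c < f x" by simp
    with lsc have "c < Liminf (at x) f"
      unfolding lower_semicontinuous_def by (auto intro: less_le_trans)
    hence "eventually (\<lambda>y. c < f y) (at x)"
      by (rule less_LiminfD)
    with c have "eventually (\<lambda>y. c < f y) (nhds x)"
      by (auto simp: eventually_at_filter elim: eventually_mono)
    thus "\<exists>T. open T \<and> x \<in> T \<and> T \<subseteq> {x. c < f x}"
      unfolding eventually_nhds by blast
  qed
next
  assume op: "\<forall>c. open {x. c < f x}"
  show "lower_semicontinuous f"
    unfolding lower_semicontinuous_def le_Liminf_iff
  proof (intro allI impI)
    fix x c assume "c < f x"
    with op have "eventually (\<lambda>y. c < f y) (nhds x)"
      unfolding eventually_nhds by blast
    thus "eventually (\<lambda>y. c < f y) (at x)"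
      by (auto simp: eventually_at_filter elim: eventually_mono)
  qed
qed

lemma lower_semicontinuous_compose:
  assumes "lower_semicontinuous f" and "continuous_on UNIV g"
  shows "lower_semicontinuous (\<lambda>x. f (g x))"
proof -
  have "open {x. c < f (g x)}" for c
    using open_vimage[OF _ assms(2), of "{y. c < f y}"] assms(1)
    by (simp add: lower_semicontinuous_iff_open vimage_def)
  thus ?thesis by (simp add: lower_semicontinuous_iff_open)
qed

lemma lower_semicontinuous_continuous:
  fixes g :: "'a::topological_space \<Rightarrow> real"
  assumes "continuous_on UNIV g"
  shows "lower_semicontinuous (\<lambda>x. ereal (g x))"
  unfolding lower_semicontinuous_iff_open
proof
  fix c
  have "continuous_on UNIV (\<lambda>x. ereal (g x))"
    using assms by (rule continuous_on_ereal)
  thus "open {x. c < ereal (g x)}"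
    using open_vimage[of "{c<..}" "\<lambda>x. ereal (g x)"] by (simp add: vimage_def)
qed

text \<open>
  Addition on \<open>ereal\<close> is lower semicontinuous away from \<open>-\<infinity>\<close>, in the form needed to combine
  superlevel sets of two functions. If both summands are finite, the slack \<open>p + q - c\<close> is
  shared equally between them. If one is infinite, the bound for it can be taken as large as needed.
\<close>

lemma ereal_less_add_split:
  fixes p q c :: ereal
  assumes "c < p + q" and "p \<noteq> -\<infinity>" and "q \<noteq> -\<infinity>"
  obtains a b where "a < p" "b < q" "\<And>p' q'. a < p' \<Longrightarrow> b < q' \<Longrightarrow> c < p' + q'"
proof (cases c)
  case PInf
  thus ?thesis using assms(1) by simp
next
  case MInf
  have "c < p' + q'" if "-\<infinity> < p'" "-\<infinity> < q'" for p' q'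
    using that MInf by (cases p'; cases q') auto
  thus ?thesis using that[of "-\<infinity>" "-\<infinity>"] assms by simp
next
  case (real r)
  have "\<exists>s t. ereal s < p \<and> ereal t < q \<and> r \<le> s + t"
  proof (cases p)
    case p: (real u)
    show ?thesis
    proof (cases q)
      case (real v)
      thus ?thesis using assms(1) p \<open>c = ereal r\<close>
        by (intro exI[of _ "u - (u + v - r) / 2"] exI[of _ "v - (u + v - r) / 2"])
          (auto simp: field_simps)
    next
      case PInf
      thus ?thesis using p by (intro exI[of _ "u - 1"] exI[of _ "r - (u - 1)"]) auto
    qed (use assms in auto)
  next
    case PInf
    obtain t where "ereal t < q"
      using assms(3) ereal_dense2[of "-\<infinity>" q] by auto
    thus ?thesis using PInf by (intro exI[of _ "r - t"] exI[of _ t]) auto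
  qed (use assms in auto)
  then obtain s t where st: "ereal s < p" "ereal t < q" "r \<le> s + t" by blast
  have "c < p' + q'" if "ereal s < p'" "ereal t < q'" for p' q'
    using that st(3) real by (cases p'; cases q') auto
  thus ?thesis using that st by blast
qed

lemma lower_semicontinuous_add:
  fixes f g :: "'a::topological_space \<Rightarrow> ereal"
  assumes "lower_semicontinuous f" and "lower_semicontinuous g"
    and "\<And>x. f x \<noteq> -\<infinity>" and "\<And>x. g x \<noteq> -\<infinity>"
  shows "lower_semicontinuous (\<lambda>x. f x + g x)"
  unfolding lower_semicontinuous_iff_open
proof (intro allI, subst open_subopen, intro ballI)
  fix c x assume "x \<in> {x. c < f x + g x}"
  then obtain a b where ab: "a < f x" "b < g x"
    "\<And>p q. a < p \<Longrightarrow> b < q \<Longrightarrow> c < p + q"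
    using ereal_less_add_split[of c "f x" "g x"] assms(3,4) by auto
  have "open ({x. a < f x} \<inter> {x. b < g x})"
    using assms(1,2) by (auto simp: lower_semicontinuous_iff_open)
  thus "\<exists>T. open T \<and> x \<in> T \<and> T \<subseteq> {x. c < f x + g x}"
    using ab by (intro exI[of _ "{x. a < f x} \<inter> {x. b < g x}"]) auto
qed

lemma lower_semicontinuous_locally_bounded_below:
  fixes f :: "'a::metric_space \<Rightarrow> ereal"
  assumes "lower_semicontinuous f" and "c < f x"
  obtains r where "r > 0" "\<And>y. y \<in> ball x r \<Longrightarrow> c < f y"
proof -
  have "open {y. c < f y}" "x \<in> {y. c < f y}"
    using assms by (auto simp: lower_semicontinuous_iff_open)
  then obtain r where "r > 0" "ball x r \<subseteq> {y. c < f y}"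
    using open_contains_ball by blast
  thus ?thesis using that by blast
qed

section \<open>Ekeland's variational principle\<close>

text \<open>
  The distance-like function \<open>p\<close> is kept separate from the metric of the type because products
  carry the Euclidean metric, while the slope is to be measured in a multiple of the maximum
  distance. The sets \<open>F x\<close> of points that are better than \<open>x\<close> by at least their distance from
  \<open>x\<close> are closed and nested along \<open>F\<close>-steps. Choosing each \<open>X (Suc n)\<close> in \<open>F (X n)\<close> almost
  minimal for \<open>f\<close> makes the diameter of \<open>F (X n)\<close> tend to zero, because a point of
  \<open>F (X (Suc n))\<close> can improve on \<open>X (Suc n)\<close> only a little. The common point \<open>x\<close> of these sets
  has \<open>F x\<close> contained in all of them, so \<open>F x = {x}\<close>, which is the minimality claimed.
\<close>

lemma ekeland:
  fixes f :: "'a::complete_space \<Rightarrow> ereal" and p :: "'a \<Rightarrow> 'a \<Rightarrow> real"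
  assumes S: "closed S" and lsc: "lower_semicontinuous f" and ninf: "\<And>x. f x \<noteq> -\<infinity>"
    and lower: "\<And>x. x \<in> S \<Longrightarrow> ereal m \<le> f x"
    and x0: "x0 \<in> S" "f x0 < \<infinity>"
    and p_refl: "\<And>x. p x x = 0" and p_tri: "\<And>x y z. p x z \<le> p x y + p y z"
    and p_cont: "\<And>x. continuous_on UNIV (\<lambda>u. p u x)"
    and C: "C > 0" and p_dist: "\<And>u x. dist u x \<le> C * p u x"
  obtains x where "x \<in> S" "f x + ereal (p x x0) \<le> f x0"
    "\<And>u. u \<in> S \<Longrightarrow> u \<noteq> x \<Longrightarrow> f x < f u + ereal (p u x)"
proof -
  define F where "F x = {u \<in> S. f u + ereal (p u x) \<le> f x}" for x
  have p_nonneg: "0 \<le> p u x" for u x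
  proof -
    have "0 \<le> C * p u x" using zero_le_dist p_dist by (rule order_trans)
    thus ?thesis using C by (simp add: zero_le_mult_iff)
  qed
  have F_refl: "x \<in> F x" if "x \<in> S" for x
    using that by (simp add: F_def p_refl flip: zero_ereal_def)
  have F_trans: "F y \<subseteq> F x" if "y \<in> F x" for x y
  proof
    fix u assume "u \<in> F y"
    hence u: "u \<in> S" "f u + ereal (p u y) \<le> f y" by (auto simp: F_def)
    have y: "f y + ereal (p y x) \<le> f x" using that by (auto simp: F_def)
    have "f u + ereal (p u x) \<le> f u + ereal (p u y + p y x)"
      using p_tri[of u x y] by (intro add_left_mono) simp
    also have "\<dots> = (f u + ereal (p u y)) + ereal (p y x)"
      by (simp add: add.assoc)
    also have "\<dots> \<le> f y + ereal (p y x)"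
      using u(2) by (rule add_right_mono)
    also have "\<dots> \<le> f x" by (rule y)
    finally show "u \<in> F x" using u(1) by (simp add: F_def)
  qed
  have F_le: "f u \<le> f x" if "u \<in> F x" for u x
  proof -
    have "f u + 0 \<le> f u + ereal (p u x)"
      using p_nonneg by (intro add_left_mono) simp
    thus ?thesis using that by (auto simp: F_def)
  qed
  have F_closed: "closed (F x)" for x
  proof -
    have "lower_semicontinuous (\<lambda>u. f u + ereal (p u x))"
      using lsc lower_semicontinuous_continuous[OF p_cont] ninf
      by (intro lower_semicontinuous_add) auto
    hence "open {u. f x < f u + ereal (p u x)}"
      by (simp add: lower_semicontinuous_iff_open)
    moreover have "F x = S - {u. f x < f u + ereal (p u x)}"
      by (auto simp: F_def)
    ultimately show ?thesis using S by auto
  qed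
  have step: "\<exists>y. (y \<in> S \<and> f y < \<infinity>) \<and> y \<in> F x \<and> (\<forall>u\<in>F y. p u y \<le> e)"
    if x: "x \<in> S" "f x < \<infinity>" and e: "e > 0" for x and e :: real
  proof -
    define v where "v = (INF u\<in>F x. f u)"
    have "v \<le> f x" unfolding v_def using F_refl[OF x(1)] by (rule INF_lower)
    moreover have "ereal m \<le> v"
      unfolding v_def using lower by (intro INF_greatest) (auto simp: F_def)
    ultimately obtain r where r: "v = ereal r"
      using x(2) by (cases v) auto
    have "v < ereal (r + e)" using r e by simp
    then obtain y where y: "y \<in> F x" "f y < ereal (r + e)"
      unfolding v_def INF_less_iff by auto
    have "p u y \<le> e" if u: "u \<in> F y" for u
    proof -
      have "ereal r \<le> f u"
        using F_trans[OF y(1)] u unfolding r[symmetric] v_def by (intro INF_lower) auto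
      moreover have "f u + ereal (p u y) < ereal (r + e)"
        using u y(2) by (auto simp: F_def)
      ultimately show ?thesis by (cases "f u") auto
    qed
    moreover have "y \<in> S" using y(1) by (simp add: F_def)
    moreover have "f y < \<infinity>" using F_le[OF y(1)] x(2) by (rule le_less_trans)
    ultimately show ?thesis using y(1) by blast
  qed
  obtain X where X: "X 0 = x0" "\<And>n. X n \<in> S" "\<And>n. X (Suc n) \<in> F (X n)"
    "\<And>n u. u \<in> F (X (Suc n)) \<Longrightarrow> p u (X (Suc n)) \<le> 1 / real (Suc n)"
  proof -
    have "\<exists>X. \<forall>n. ((X n \<in> S \<and> f (X n) < \<infinity>) \<and> (n = 0 \<longrightarrow> X n = x0)) \<and>
      (X (Suc n) \<in> F (X n) \<and> (\<forall>u\<in>F (X (Suc n)). p u (X (Suc n)) \<le> 1 / real (Suc n)))"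
    proof (rule dependent_nat_choice)
      show "\<exists>x. (x \<in> S \<and> f x < \<infinity>) \<and> (0 = (0::nat) \<longrightarrow> x = x0)"
        using x0 by blast
    next
      fix x and n :: nat
      assume "(x \<in> S \<and> f x < \<infinity>) \<and> (n = 0 \<longrightarrow> x = x0)"
      thus "\<exists>y. ((y \<in> S \<and> f y < \<infinity>) \<and> (Suc n = 0 \<longrightarrow> y = x0)) \<and>
          y \<in> F x \<and> (\<forall>u\<in>F y. p u y \<le> 1 / real (Suc n))"
        using step[of x "1 / real (Suc n)"] by auto
    qed
    then obtain X where "\<And>n. n = 0 \<longrightarrow> X n = x0" "\<And>n. X n \<in> S" "\<And>n. X (Suc n) \<in> F (X n)"
      "\<And>n. \<forall>u\<in>F (X (Suc n)). p u (X (Suc n)) \<le> 1 / real (Suc n)"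
      by auto
    thus ?thesis by (intro that[of X]) auto
  qed
  have nested: "F (X n) \<subseteq> F (X k)" if "k \<le> n" for k n
    using that
  proof (induction rule: dec_induct)
    case (step n)
    thus ?case using F_trans[OF X(3)[of n]] by blast
  qed simp
  have small: "\<exists>n. \<forall>x\<in>F (X n). \<forall>y\<in>F (X n). dist x y < e" if e: "e > 0" for e
  proof -
    obtain n where n: "1 / real (Suc n) < e / (2 * C)"
      using e C nat_approx_posE[of "e / (2 * C)"] by auto
    have half: "dist u (X (Suc n)) < e / 2" if "u \<in> F (X (Suc n))" for u
    proof -
      have "dist u (X (Suc n)) \<le> C * p u (X (Suc n))" by (rule p_dist)
      also have "\<dots> < C * (e / (2 * C))"
        using X(4)[OF that] n C by (intro mult_strict_left_mono) auto
      also have "\<dots> = e / 2" using C by simp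
      finally show ?thesis .
    qed
    have "dist y z < e" if "y \<in> F (X (Suc n))" "z \<in> F (X (Suc n))" for y z
      using half[OF that(1)] half[OF that(2)] by (rule dist_triangle_half_l)
    thus ?thesis by blast
  qed
  obtain x where x: "\<And>n. x \<in> F (X n)"
  proof (rule decreasing_closed_nest[of "\<lambda>n. F (X n)"])
    show "F (X n) \<noteq> {}" for n using F_refl[OF X(2)] by blast
  qed (use F_closed nested small that in auto)
  have unique: "u = x" if "u \<in> F x" for u
  proof (rule ccontr)
    assume "u \<noteq> x"
    then obtain n where "\<forall>y\<in>F (X n). \<forall>z\<in>F (X n). dist y z < dist u x"
      using small[of "dist u x"] by auto
    moreover have "u \<in> F (X n)" using F_trans[OF x] that by blast
    ultimately show False using x[of n] by blast
  qed
  show ?thesis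
  proof
    show "x \<in> S" using x by (auto simp: F_def)
    show "f x + ereal (p x x0) \<le> f x0"
      using x[of 0] X(1) by (auto simp: F_def)
    show "f x < f u + ereal (p u x)" if "u \<in> S" "u \<noteq> x" for u
      using that unique[of u] by (auto simp: F_def not_le[symmetric])
  qed
qed

section \<open>Uniform lower bounds\<close>

text \<open>
  The infimum in the definition of \<open>Lambda_circ\<close> is antimonotone in \<open>\<eta>\<close>, so its limit is its
  supremum over positive \<open>\<eta>\<close>, and a number below the limit is already below one of the infima.
\<close>

lemma Lambda_circ_lower_bound:
  fixes V :: "'a::metric_space set"
  assumes "c < Lambda_circ V f1 f2"
  obtains h where "h > 0"
    "\<And>x1 x2. x1 \<in> V \<Longrightarrow> x2 \<in> V \<Longrightarrow> dist x1 x2 < h \<Longrightarrow> c < f1 x1 + f2 x2"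
proof -
  define g where
    "g \<eta> = (INF (x1, x2)\<in>{(x1, x2). x1 \<in> V \<and> x2 \<in> V \<and> dist x1 x2 < \<eta>}. f1 x1 + f2 x2)"
    for \<eta> :: real
  have anti: "g t \<le> g s" if "s \<le> t" for s t
    unfolding g_def using that by (intro INF_superset_mono) auto
  have "(g \<longlongrightarrow> (SUP \<eta>\<in>{0<..}. g \<eta>)) (at_right 0)"
  proof (rule order_tendstoI)
    fix a assume "a < (SUP \<eta>\<in>{0<..}. g \<eta>)"
    then obtain t where "t > 0" "a < g t" unfolding less_SUP_iff by auto
    thus "eventually (\<lambda>s. a < g s) (at_right 0)"
      unfolding eventually_at_right_field
      using less_le_trans[OF \<open>a < g t\<close> anti] by (intro exI[of _ t]) auto
  next
    fix a assume "(SUP \<eta>\<in>{0<..}. g \<eta>) < a"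
    hence "g s < a" if "s > 0" for s
      using that by (intro le_less_trans[OF SUP_upper[of s "{0<..}" g]]) auto
    thus "eventually (\<lambda>s. g s < a) (at_right 0)"
      unfolding eventually_at_right_field by (intro exI[of _ 1]) auto
  qed
  hence "Lambda_circ V f1 f2 = (SUP \<eta>\<in>{0<..}. g \<eta>)"
    unfolding Lambda_circ_def g_def by (intro tendsto_Lim) auto
  with assms obtain h where h: "h > 0" "c < g h"
    by (auto simp: less_SUP_iff)
  show ?thesis
  proof
    fix x1 x2 assume "x1 \<in> V" "x2 \<in> V" "dist x1 x2 < h"
    hence "g h \<le> f1 x1 + f2 x2"
      unfolding g_def by (intro INF_lower2[of "(x1, x2)"]) auto
    with h(2) show "c < f1 x1 + f2 x2" by (rule less_le_trans)
  qed (rule h(1))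
qed

lemma quasiuniform_min_lower_bound:
  fixes x :: "'a::metric_space"
  assumes qmin: "quasiuniform_min e d f1 f2 x" and "r < d" and fx: "f1 x + f2 x = ereal a"
  obtains h where "h > 0"
    "\<And>u v. u \<in> cball x r \<Longrightarrow> v \<in> cball x r \<Longrightarrow> dist u v < h \<Longrightarrow> ereal (a - e) < f1 u + f2 v"
proof -
  have "(\<Union>u\<in>cball x r. ball u (d - r)) \<subseteq> ball x d"
  proof
    fix y assume "y \<in> (\<Union>u\<in>cball x r. ball u (d - r))"
    then obtain u where "dist x u \<le> r" "dist u y < d - r" by auto
    thus "y \<in> ball x d" using dist_triangle[of x y u] by simp
  qed
  hence "cball x r \<in> EI (ball x d)"
    unfolding EI_def using \<open>r < d\<close> by (auto intro!: exI[of _ "d - r"])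
  hence "Lambda_dagger (ball x d) f1 f2 \<le> Lambda_circ (cball x r) f1 f2"
    unfolding Lambda_dagger_def by (rule INF_lower)
  moreover have "ereal a < Lambda_dagger (ball x d) f1 f2 + ereal e"
    using qmin fx by (simp add: quasiuniform_min_def)
  ultimately have "ereal a < Lambda_circ (cball x r) f1 f2 + ereal e"
    by (auto intro: less_le_trans add_right_mono)
  hence "ereal (a - e) < Lambda_circ (cball x r) f1 f2"
    by (cases "Lambda_circ (cball x r) f1 f2") auto
  thus ?thesis
  proof (rule Lambda_circ_lower_bound)
    fix h :: real
    assume "h > 0" "\<And>u v. u \<in> cball x r \<Longrightarrow> v \<in> cball x r \<Longrightarrow> dist u v < h \<Longrightarrow>
      ereal (a - e) < f1 u + f2 v"
    thus ?thesis by (rule that)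
  qed
qed

text \<open>
  A bound that holds only for nearby components extends to all pairs once \<open>\<gamma>\<close> is so large that
  the penalty \<open>\<gamma> h\<close> makes up for the gap between \<open>c\<close> and the crude bound \<open>m\<close>.
\<close>

lemma penalized_lower_bound:
  assumes near: "dist u v < h \<Longrightarrow> ereal c < f1 u + f2 v"
    and crude: "ereal m \<le> f1 u + f2 v" and gap: "c - m < \<gamma> * h" and "\<gamma> > 0"
  shows "ereal c < penalized f1 f2 \<gamma> (u, v)"
proof (cases "dist u v < h")
  case True
  have "f1 u + f2 v + 0 \<le> penalized f1 f2 \<gamma> (u, v)"
    unfolding penalized_def fst_conv snd_conv using \<open>\<gamma> > 0\<close>
    by (intro add_left_mono) simp
  thus ?thesis using near[OF True] by simp
next
  case False
  hence "\<gamma> * h \<le> \<gamma> * dist u v" using \<open>\<gamma> > 0\<close> by simp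
  hence "ereal c < ereal m + ereal (\<gamma> * dist u v)" using gap by simp
  also have "\<dots> \<le> penalized f1 f2 \<gamma> (u, v)"
    unfolding penalized_def fst_conv snd_conv using crude by (rule add_right_mono)
  finally show ?thesis .
qed

section \<open>The penalized sum on the product\<close>

lemma penalized_not_MInf:
  assumes "\<And>x. f1 x \<noteq> -\<infinity>" and "\<And>x. f2 x \<noteq> -\<infinity>"
  shows "penalized f1 f2 \<gamma> u \<noteq> -\<infinity>"
  using assms by (simp add: penalized_def)

lemma lower_semicontinuous_penalized:
  fixes f1 f2 :: "'a::metric_space \<Rightarrow> ereal"
  assumes "\<And>x. f1 x \<noteq> -\<infinity>" and "\<And>x. f2 x \<noteq> -\<infinity>"
    and "lower_semicontinuous f1" and "lower_semicontinuous f2"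
  shows "lower_semicontinuous (penalized f1 f2 \<gamma>)"
proof -
  have "lower_semicontinuous (\<lambda>u::'a \<times> 'a. f1 (fst u))"
    using assms(3) continuous_on_fst[OF continuous_on_id] by (rule lower_semicontinuous_compose)
  moreover have "lower_semicontinuous (\<lambda>u::'a \<times> 'a. f2 (snd u))"
    using assms(4) continuous_on_snd[OF continuous_on_id] by (rule lower_semicontinuous_compose)
  moreover have "lower_semicontinuous (\<lambda>u::'a \<times> 'a. ereal (\<gamma> * dist (fst u) (snd u)))"
    by (intro lower_semicontinuous_continuous continuous_intros)
  ultimately have "lower_semicontinuous
      (\<lambda>u. f1 (fst u) + f2 (snd u) + ereal (\<gamma> * dist (fst u) (snd u)))"
    using assms(1,2) by (intro lower_semicontinuous_add) auto
  thus ?thesis by (simp add: penalized_def[abs_def])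
qed

lemma max_dist_triangle: "max_dist p r \<le> max_dist p q + max_dist q r"
  using dist_triangle[of "fst p" "fst r" "fst q"] dist_triangle[of "snd p" "snd r" "snd q"]
  by (auto simp: max_dist_def max_def)

lemma dist_le_max_dist: "dist p q \<le> 2 * max_dist p q"
proof -
  have "dist p q \<le> dist (fst p) (fst q) + dist (snd p) (snd q)"
    unfolding dist_prod_def by (intro sqrt_sum_squares_le_sum) auto
  thus ?thesis by (simp add: max_dist_def)
qed

lemma max_dist_pos: "u \<noteq> v \<Longrightarrow> 0 < max_dist u v"
  using dist_le_max_dist[of u v] zero_less_dist_iff[of u v] by linarith

text \<open>
  The maximum distance is comparable to the Euclidean product metric, in which the product is
  complete, so \<open>k * max_dist\<close> may take the role of \<open>p\<close> in \<open>ekeland\<close>.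
\<close>

lemma ekeland_max_dist:
  fixes f :: "'a::complete_space \<times> 'a \<Rightarrow> ereal"
  assumes "closed S" and "lower_semicontinuous f" and "\<And>x. f x \<noteq> -\<infinity>"
    and "\<And>x. x \<in> S \<Longrightarrow> ereal m \<le> f x" and "x0 \<in> S" and "f x0 < \<infinity>" and "k > 0"
  obtains x where "x \<in> S" "f x + ereal (k * max_dist x x0) \<le> f x0"
    "\<And>u. u \<in> S \<Longrightarrow> u \<noteq> x \<Longrightarrow> f x < f u + ereal (k * max_dist u x)"
proof (rule ekeland[OF assms(1-3) _ assms(5,6), where C = "2 / k" and p = "\<lambda>u x. k * max_dist u x"])
  show "k * max_dist x x = 0" for x :: "'a \<times> 'a"
    by (simp add: max_dist_def)
  show "k * max_dist x z \<le> k * max_dist x y + k * max_dist y z" for x y z :: "'a \<times> 'a"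
    using max_dist_triangle[of x z y] \<open>k > 0\<close> by (simp flip: distrib_left)
  show "continuous_on UNIV (\<lambda>u. k * max_dist u x)" for x :: "'a \<times> 'a"
    unfolding max_dist_def by (intro continuous_intros)
  show "0 < 2 / k" using \<open>k > 0\<close> by simp
  show "dist u x \<le> 2 / k * (k * max_dist u x)" for u x :: "'a \<times> 'a"
    using dist_le_max_dist[of u x] \<open>k > 0\<close> by simp
next
  fix x assume "x \<in> S" "f x + ereal (k * max_dist x x0) \<le> f x0"
    "\<And>u. u \<in> S \<Longrightarrow> u \<noteq> x \<Longrightarrow> f x < f u + ereal (k * max_dist u x)"
  thus thesis by (rule that)
qed (rule assms(4))

theorem corollary6p9:
  fixes \<phi>1 \<phi>2 :: "'a::complete_space \<Rightarrow> ereal" and xbar :: 'a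
  assumes "\<And>x. \<phi>1 x \<noteq> -\<infinity>" and "\<And>x. \<phi>2 x \<noteq> -\<infinity>"
    and "lower_semicontinuous \<phi>1" and "lower_semicontinuous \<phi>2"
    and "xbar \<in> eff_dom \<phi>1 \<inter> eff_dom \<phi>2"
    and "quasiuniform_stationary \<phi>1 \<phi>2 xbar"
  shows "\<forall>\<epsilon>::real. \<epsilon> > 0 \<longrightarrow> (\<exists>\<rho>::real. 0 < \<rho> \<and> \<rho> < \<epsilon> \<and>
    (\<forall>\<eta>::real. \<eta> > 0 \<longrightarrow> (\<exists>(\<gamma>::real) x1 x2. \<gamma> > 0 \<and>
       max_dist (x1, x2) (xbar, xbar) < \<rho> \<and>
       dist x1 x2 < \<eta> \<and>
       penalized \<phi>1 \<phi>2 \<gamma> (x1, x2) \<le> \<phi>1 xbar + \<phi>2 xbar \<and>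
       (SUP u\<in>cball xbar \<rho> \<times> cball xbar \<rho> - {(x1, x2)}.
          (penalized \<phi>1 \<phi>2 \<gamma> (x1, x2) - penalized \<phi>1 \<phi>2 \<gamma> u)
            / ereal (max_dist u (x1, x2))) < ereal \<epsilon>)))"
proof (intro allI impI)
  fix \<epsilon> :: real assume \<epsilon>: "\<epsilon> > 0"
  obtain a1 where a1: "\<phi>1 xbar = ereal a1"
    using assms(1)[of xbar] assms(5) by (cases "\<phi>1 xbar") (auto simp: eff_dom_def)
  obtain a2 where a2: "\<phi>2 xbar = ereal a2"
    using assms(2)[of xbar] assms(5) by (cases "\<phi>2 xbar") (auto simp: eff_dom_def)
  define a where "a = a1 + a2"
  have a: "\<phi>1 xbar + \<phi>2 xbar = ereal a" by (simp add: a1 a2 a_def)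
  have "\<epsilon> / 4 > 0" using \<epsilon> by simp
  then obtain \<delta>0 where \<delta>0: "\<delta>0 > 0"
    "\<And>\<delta>. 0 < \<delta> \<Longrightarrow> \<delta> < \<delta>0 \<Longrightarrow> quasiuniform_min (\<epsilon> / 4 * \<delta>) \<delta> \<phi>1 \<phi>2 xbar"
    using assms(6) unfolding quasiuniform_stationary_def by blast
  obtain r1 where r1: "r1 > 0" "\<And>y. y \<in> ball xbar r1 \<Longrightarrow> ereal (a1 - 1) < \<phi>1 y"
    using lower_semicontinuous_locally_bounded_below[OF assms(3), of "ereal (a1 - 1)" xbar] a1
    by auto
  obtain r2 where r2: "r2 > 0" "\<And>y. y \<in> ball xbar r2 \<Longrightarrow> ereal (a2 - 1) < \<phi>2 y"
    using lower_semicontinuous_locally_bounded_below[OF assms(4), of "ereal (a2 - 1)" xbar] a2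
    by auto
  \<comment> \<open>Stationarity is used on the ball of radius \<open>2 * \<rho>\<close>, so that the closed \<open>\<rho>\<close>-ball is
    essentially interior to it. Its error \<open>\<epsilon> / 4 * (2 * \<rho>)\<close> is exactly slope \<open>\<epsilon> / 2\<close> times \<open>\<rho>\<close>.\<close>
  define \<rho> where "\<rho> = min (min (\<epsilon> / 2) (\<delta>0 / 4)) (min (r1 / 2) (r2 / 2))"
  have \<rho>: "0 < \<rho>" "\<rho> < \<epsilon>" "2 * \<rho> < \<delta>0" "\<rho> < r1" "\<rho> < r2"
    using \<epsilon> \<delta>0(1) r1(1) r2(1) unfolding \<rho>_def by (auto simp: min_def)
  define B where "B = cball xbar \<rho>"
  have crude: "ereal (a - 2) \<le> \<phi>1 u + \<phi>2 v" if "u \<in> B" "v \<in> B" for u v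
  proof -
    have "ereal (a1 - 1) + ereal (a2 - 1) \<le> \<phi>1 u + \<phi>2 v"
      using that \<rho> r1(2)[of u] r2(2)[of v]
      by (intro add_mono) (auto simp: B_def intro!: less_imp_le)
    thus ?thesis by (simp add: a_def)
  qed
  have "quasiuniform_min (\<epsilon> * \<rho> / 2) (2 * \<rho>) \<phi>1 \<phi>2 xbar"
    using \<delta>0(2)[of "2 * \<rho>"] \<rho> by simp
  then obtain h where h: "h > 0" "\<And>u v. u \<in> B \<Longrightarrow> v \<in> B \<Longrightarrow> dist u v < h \<Longrightarrow>
      ereal (a - \<epsilon> * \<rho> / 2) < \<phi>1 u + \<phi>2 v"
    unfolding B_def
  proof (rule quasiuniform_min_lower_bound)
    show "\<rho> < 2 * \<rho>" using \<rho>(1) by simp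
  qed (use a that in auto)
  show "\<exists>\<rho>::real. 0 < \<rho> \<and> \<rho> < \<epsilon> \<and>
    (\<forall>\<eta>::real. \<eta> > 0 \<longrightarrow> (\<exists>(\<gamma>::real) x1 x2. \<gamma> > 0 \<and>
       max_dist (x1, x2) (xbar, xbar) < \<rho> \<and>
       dist x1 x2 < \<eta> \<and>
       penalized \<phi>1 \<phi>2 \<gamma> (x1, x2) \<le> \<phi>1 xbar + \<phi>2 xbar \<and>
       (SUP u\<in>cball xbar \<rho> \<times> cball xbar \<rho> - {(x1, x2)}.
          (penalized \<phi>1 \<phi>2 \<gamma> (x1, x2) - penalized \<phi>1 \<phi>2 \<gamma> u)
            / ereal (max_dist u (x1, x2))) < ereal \<epsilon>))"
  proof (rule exI[of _ \<rho>], intro conjI allI impI)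
    fix \<eta> :: real assume \<eta>: "\<eta> > 0"
    \<comment> \<open>Both requirements on \<open>\<gamma>\<close> come from the crude bound \<open>a - 2\<close>: with \<open>\<gamma> h > 2\<close> the
      penalty compensates for it, and \<open>\<gamma> \<eta> > 2\<close> keeps the components of the Ekeland point
      within \<open>\<eta>\<close> of each other.\<close>
    define \<gamma> where "\<gamma> = 2 / h + 2 / \<eta> + 1"
    have \<gamma>: "\<gamma> > 0" "\<gamma> * h > 2" "\<gamma> * \<eta> > 2"
      using h(1) \<eta> by (auto simp: \<gamma>_def field_simps add_pos_pos)
    define f where "f = penalized \<phi>1 \<phi>2 \<gamma>"
    have f_base: "f (xbar, xbar) = ereal a" by (simp add: f_def penalized_def a)
    have "a - \<epsilon> * \<rho> / 2 - (a - 2) < \<gamma> * h"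
      using \<gamma>(2) mult_pos_pos[OF \<epsilon> \<rho>(1)] by simp
    hence f_lower: "ereal (a - \<epsilon> * \<rho> / 2) < f u" if "u \<in> B \<times> B" for u
      using that h(2) crude \<gamma>(1) unfolding f_def
      by (cases u) (auto intro!: penalized_lower_bound[where h = h and m = "a - 2"])
    obtain x where x: "x \<in> B \<times> B"
      "f x + ereal (\<epsilon> / 2 * max_dist x (xbar, xbar)) \<le> ereal a"
      "\<And>u. u \<in> B \<times> B \<Longrightarrow> u \<noteq> x \<Longrightarrow> f x < f u + ereal (\<epsilon> / 2 * max_dist u x)"
    proof (rule ekeland_max_dist)
      show "closed (B \<times> B)" by (simp add: B_def closed_Times)
      show "lower_semicontinuous f"
        unfolding f_def by (rule lower_semicontinuous_penalized[OF assms(1-4)])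
      show "f u \<noteq> -\<infinity>" for u
        unfolding f_def by (rule penalized_not_MInf[OF assms(1,2)])
      show "ereal (a - \<epsilon> * \<rho> / 2) \<le> f u" if "u \<in> B \<times> B" for u
        using f_lower[OF that] by (rule less_imp_le)
      show "(xbar, xbar) \<in> B \<times> B" using \<rho>(1) by (simp add: B_def)
      show "f (xbar, xbar) < \<infinity>" by (simp add: f_base)
      show "\<epsilon> / 2 > 0" using \<epsilon> by simp
    next
      fix x assume "x \<in> B \<times> B" "f x + ereal (\<epsilon> / 2 * max_dist x (xbar, xbar)) \<le> f (xbar, xbar)"
        "\<And>u. u \<in> B \<times> B \<Longrightarrow> u \<noteq> x \<Longrightarrow> f x < f u + ereal (\<epsilon> / 2 * max_dist u x)"
      thus thesis using that unfolding f_base by simp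
    qed
    obtain x1 x2 where x12: "x = (x1, x2)" by (cases x)
    obtain b where b: "f x = ereal b"
      using f_lower[OF x(1)] x(2) by (cases "f x") auto
    have b_lower: "a - \<epsilon> * \<rho> / 2 < b" using f_lower[OF x(1)] b by simp
    have b_upper: "b + \<epsilon> / 2 * max_dist x (xbar, xbar) \<le> a" using x(2) b by simp
    have "0 \<le> \<epsilon> / 2 * max_dist x (xbar, xbar)"
      using \<epsilon> by (intro mult_nonneg_nonneg) (simp_all add: max_dist_def le_max_iff_disj)
    with b_upper have "b \<le> a" by simp
    have near: "max_dist x (xbar, xbar) < \<rho>"
    proof -
      have "\<epsilon> / 2 * max_dist x (xbar, xbar) < \<epsilon> / 2 * \<rho>"
        using b_lower b_upper by simp
      thus ?thesis using \<epsilon> by simp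
    qed
    have close: "dist x1 x2 < \<eta>"
    proof -
      have "ereal (a - 2) + ereal (\<gamma> * dist x1 x2) \<le> f x"
        using crude[of x1 x2] x(1) unfolding x12 f_def penalized_def fst_conv snd_conv
        by (intro add_right_mono) auto
      hence "\<gamma> * dist x1 x2 < \<gamma> * \<eta>" using b \<open>b \<le> a\<close> \<gamma>(3) by simp
      thus ?thesis using \<gamma>(1) by simp
    qed
    have "(SUP u\<in>B \<times> B - {x}. (f x - f u) / ereal (max_dist u x)) \<le> ereal (\<epsilon> / 2)"
    proof (rule SUP_least)
      fix u assume u: "u \<in> B \<times> B - {x}"
      hence pos: "0 < max_dist u x" by (simp add: max_dist_pos)
      have "f x < f u + ereal (\<epsilon> / 2 * max_dist u x)" using x(3) u by simp
      hence "f x - f u \<le> ereal (\<epsilon> / 2 * max_dist u x)"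
        using b f_lower[of u] u by (cases "f u") auto
      thus "(f x - f u) / ereal (max_dist u x) \<le> ereal (\<epsilon> / 2)"
        using pos by (subst ereal_divide_le_pos) (auto simp: mult.commute)
    qed
    also have "\<dots> < ereal \<epsilon>" using \<epsilon> by simp
    finally have slope:
      "(SUP u\<in>B \<times> B - {x}. (f x - f u) / ereal (max_dist u x)) < ereal \<epsilon>" .
    have "f x \<le> \<phi>1 xbar + \<phi>2 xbar" using b \<open>b \<le> a\<close> a by simp
    thus "\<exists>(\<gamma>::real) x1 x2. \<gamma> > 0 \<and>
       max_dist (x1, x2) (xbar, xbar) < \<rho> \<and>
       dist x1 x2 < \<eta> \<and>
       penalized \<phi>1 \<phi>2 \<gamma> (x1, x2) \<le> \<phi>1 xbar + \<phi>2 xbar \<and>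
       (SUP u\<in>cball xbar \<rho> \<times> cball xbar \<rho> - {(x1, x2)}.
          (penalized \<phi>1 \<phi>2 \<gamma> (x1, x2) - penalized \<phi>1 \<phi>2 \<gamma> u)
            / ereal (max_dist u (x1, x2))) < ereal \<epsilon>"
      using \<gamma>(1) near close slope unfolding x12 f_def B_def
      by (intro exI[of _ \<gamma>] exI[of _ x1] exI[of _ x2] conjI)
  qed (fact \<rho>)+
qed

end
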